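(* Let $A \in \mathbb{R}^{n\times n}$ be a square matrix and $\eta \in \mathbb{R}$, and let $\alpha$ be the characteristic polynomial of the matrix $\eta^2 A A^T$. Let $$B = \begin{pmatrix} \mathbf{I}_n & -2\eta A \\ 2\eta A^T & \mathbf{I}_n \end{pmatrix}, \qquad C = \begin{pmatrix} \mathbf{0}_n & \eta A \\ -\eta A^T & \mathbf{0}_n \end{pmatrix}.$$ Then the characteristic equation $\det(z^2 \mathbf{I}_{2n} - zB - C) = 0$ of OGDA can be expressed as $$\alpha\left( - \left( \frac{z^2 - z}{2z-1} \right)^2 \right) = 0 ;$$ that is, $z = 1/2$ is not a root of the characteristic equation, and for every $z \in \mathbb{C}\setminus\{1/2\}$ the two equations are equivalent.
   Context: OGDA (Optimistic Gradient Descent/Ascent) for the bilinear game $f(\mathbf{x},\mathbf{y}) = \mathbf{x}^TA\mathbf{y}$ is the recursion $\mathbf{x}_{t+2} = \mathbf{x}_{t+1} - 2\eta A\mathbf{y}_{t+1} + \eta A \mathbf{y}_t$, $\mathbf{y}_{t+2} = \mathbf{y}_{t+1} + 2\eta A^T\mathbf{x}_{t+1} - \eta A^T\mathbf{x}_t$ for $t\ge 0$. With $\mathbf{w}_t = (\mathbf{x}_t, \mathbf{y}_t)^T$ it reads $\mathbf{w}_{t+2} = B\mathbf{w}_{t+1} + C\mathbf{w}_t$, and its characteristic equation is $\det(z^2\mathbf{I}_{2n} - zB - C) = 0$. $\mathbf{I}_k$ and $\mathbf{0}_k$ denote the $k\times k$ identity and zero matrices. *)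

theory Defs
  imports "Jordan_Normal_Form.Char_Poly" Complex_Main
begin

definition ogda_B :: "nat \<Rightarrow> real \<Rightarrow> real mat \<Rightarrow> real mat" where
  "ogda_B n \<eta> A =
     four_block_mat (1\<^sub>m n)                 ((-2 * \<eta>) \<cdot>\<^sub>m A)
                    ((2 * \<eta>) \<cdot>\<^sub>m A\<^sup>T)  (1\<^sub>m n)"

definition ogda_C :: "nat \<Rightarrow> real \<Rightarrow> real mat \<Rightarrow> real mat" where
  "ogda_C n \<eta> A =
     four_block_mat (0\<^sub>m n n)         (\<eta> \<cdot>\<^sub>m A)
                    ((-\<eta>) \<cdot>\<^sub>m A\<^sup>T)  (0\<^sub>m n n)"

text \<open>The left-hand side of the characteristic equation; the real matrices are embedded
  into the complex ones because the roots \<open>z\<close> are complex.\<close>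

definition ogda_char_det :: "nat \<Rightarrow> real \<Rightarrow> real mat \<Rightarrow> complex \<Rightarrow> complex" where
  "ogda_char_det n \<eta> A z =
     det (z\<^sup>2 \<cdot>\<^sub>m 1\<^sub>m (2 * n)
          - z \<cdot>\<^sub>m map_mat complex_of_real (ogda_B n \<eta> A)
          - map_mat complex_of_real (ogda_C n \<eta> A))"

text \<open>With \<open>w = x @\<^sub>v y\<close> the OGDA recursion for \<open>f(x, y) = x\<^sup>T A y\<close> is exactly the
  block recursion given by \<^const>\<open>ogda_B\<close> and \<^const>\<open>ogda_C\<close>.\<close>

lemma ogda_step_iff:
  fixes A :: "real mat"
  assumes A: "A \<in> carrier_mat n n"
    and x: "x0 \<in> carrier_vec n" "x1 \<in> carrier_vec n" "x2 \<in> carrier_vec n"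
    and y: "y0 \<in> carrier_vec n" "y1 \<in> carrier_vec n" "y2 \<in> carrier_vec n"
  shows "x2 @\<^sub>v y2 = ogda_B n \<eta> A *\<^sub>v (x1 @\<^sub>v y1) + ogda_C n \<eta> A *\<^sub>v (x0 @\<^sub>v y0) \<longleftrightarrow>
      x2 = x1 - (2 * \<eta>) \<cdot>\<^sub>v (A *\<^sub>v y1) + \<eta> \<cdot>\<^sub>v (A *\<^sub>v y0) \<and>
      y2 = y1 + (2 * \<eta>) \<cdot>\<^sub>v (A\<^sup>T *\<^sub>v x1) - \<eta> \<cdot>\<^sub>v (A\<^sup>T *\<^sub>v x0)"
proof -
  have At: "A\<^sup>T \<in> carrier_mat n n" using A by simp
  have B: "ogda_B n \<eta> A *\<^sub>v (x1 @\<^sub>v y1) =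
      (1\<^sub>m n *\<^sub>v x1 + ((-2 * \<eta>) \<cdot>\<^sub>m A) *\<^sub>v y1) @\<^sub>v (((2 * \<eta>) \<cdot>\<^sub>m A\<^sup>T) *\<^sub>v x1 + 1\<^sub>m n *\<^sub>v y1)"
    unfolding ogda_B_def by (rule four_block_mat_mult_vec) (use A x y in auto)
  have C: "ogda_C n \<eta> A *\<^sub>v (x0 @\<^sub>v y0) =
      (0\<^sub>m n n *\<^sub>v x0 + (\<eta> \<cdot>\<^sub>m A) *\<^sub>v y0) @\<^sub>v (((-\<eta>) \<cdot>\<^sub>m A\<^sup>T) *\<^sub>v x0 + 0\<^sub>m n n *\<^sub>v y0)"
    unfolding ogda_C_def by (rule four_block_mat_mult_vec) (use A x y in auto)
  have 1: "(1\<^sub>m n *\<^sub>v x1 + ((-2 * \<eta>) \<cdot>\<^sub>m A) *\<^sub>v y1) + (0\<^sub>m n n *\<^sub>v x0 + (\<eta> \<cdot>\<^sub>m A) *\<^sub>v y0)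
      = x1 - (2 * \<eta>) \<cdot>\<^sub>v (A *\<^sub>v y1) + \<eta> \<cdot>\<^sub>v (A *\<^sub>v y0)"
    using A x y by (intro eq_vecI) auto
  have 2: "(((2 * \<eta>) \<cdot>\<^sub>m A\<^sup>T) *\<^sub>v x1 + 1\<^sub>m n *\<^sub>v y1) + (((-\<eta>) \<cdot>\<^sub>m A\<^sup>T) *\<^sub>v x0 + 0\<^sub>m n n *\<^sub>v y0)
      = y1 + (2 * \<eta>) \<cdot>\<^sub>v (A\<^sup>T *\<^sub>v x1) - \<eta> \<cdot>\<^sub>v (A\<^sup>T *\<^sub>v x0)"
    using A x y by (intro eq_vecI) auto
  have "ogda_B n \<eta> A *\<^sub>v (x1 @\<^sub>v y1) + ogda_C n \<eta> A *\<^sub>v (x0 @\<^sub>v y0) =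
      (x1 - (2 * \<eta>) \<cdot>\<^sub>v (A *\<^sub>v y1) + \<eta> \<cdot>\<^sub>v (A *\<^sub>v y0)) @\<^sub>v
      (y1 + (2 * \<eta>) \<cdot>\<^sub>v (A\<^sup>T *\<^sub>v x1) - \<eta> \<cdot>\<^sub>v (A\<^sup>T *\<^sub>v x0))"
    unfolding B C 1[symmetric] 2[symmetric]
    by (rule append_vec_add[of _ n _ _ n]; rule carrier_vecI) (use A x y in auto)
  moreover have "x1 - (2 * \<eta>) \<cdot>\<^sub>v (A *\<^sub>v y1) + \<eta> \<cdot>\<^sub>v (A *\<^sub>v y0) \<in> carrier_vec n"
    using A by (intro carrier_vecI) simp
  ultimately show ?thesis
    using append_vec_eq[OF x(3)] by metis
qed

end

theory Submission
  imports Defs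
begin

text \<open>The blocks of \<open>z\<^sup>2 I - z B - C\<close> on the diagonal are the scalar matrix \<open>(z\<^sup>2 - z) I\<close>, which
  commutes with everything, so its determinant is that of the Schur-type combination
  \<open>(z\<^sup>2 - z)\<^sup>2 I + (2 z - 1)\<^sup>2 \<eta>\<^sup>2 A A\<^sup>T\<close>. At \<open>z = 1/2\<close> this is a nonzero scalar matrix; otherwise
  dividing by \<open>- (2 z - 1)\<^sup>2\<close> turns it into the characteristic matrix of \<open>\<eta>\<^sup>2 A A\<^sup>T\<close>.\<close>

lemma det_four_block_scalar_diag:
  fixes P Q :: "'a::idom mat"
  assumes P: "P \<in> carrier_mat n n" and Q: "Q \<in> carrier_mat n n"
  shows "det (four_block_mat (w \<cdot>\<^sub>m 1\<^sub>m n) P Q (w \<cdot>\<^sub>m 1\<^sub>m n)) = det (w\<^sup>2 \<cdot>\<^sub>m 1\<^sub>m n - P * Q)"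
proof -
  \<comment> \<open>The block formula \<open>det_four_block_mat\<close> asks for commuting lower
    blocks rather than an invertible diagonal block, so \<open>w = 0\<close> is covered too.\<close>
  have "Q * (w \<cdot>\<^sub>m 1\<^sub>m n) = w \<cdot>\<^sub>m 1\<^sub>m n * Q"
    using Q by (simp add: mult_smult_distrib[OF Q one_carrier_mat] mult_smult_assoc_mat[OF one_carrier_mat Q])
  then have "det (four_block_mat (w \<cdot>\<^sub>m 1\<^sub>m n) P Q (w \<cdot>\<^sub>m 1\<^sub>m n))
      = det (w \<cdot>\<^sub>m 1\<^sub>m n * (w \<cdot>\<^sub>m 1\<^sub>m n) - P * Q)"
    using P Q by (intro det_four_block_mat) auto
  also have "w \<cdot>\<^sub>m 1\<^sub>m n * (w \<cdot>\<^sub>m 1\<^sub>m n) = w\<^sup>2 \<cdot>\<^sub>m (1\<^sub>m n :: 'a mat)"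
    by (subst mult_smult_assoc_mat[of _ n n _ n]) (auto simp: power2_eq_square)
  finally show ?thesis .
qed

text \<open>With \<open>k = - (w / v)\<close>, the matrix \<open>k I - N\<close> is
  \<open>- 1 / v\<close> times \<open>w I + v N\<close>; each of the \<open>n\<close> columns
  contributes this factor to the determinant.\<close>

lemma poly_char_poly_scaled:
  fixes N :: "'a::field mat"
  assumes N: "N \<in> carrier_mat n n" and v: "v \<noteq> 0"
  shows "poly (char_poly N) (- (w / v)) = (- 1 / v) ^ n * det (w \<cdot>\<^sub>m 1\<^sub>m n + v \<cdot>\<^sub>m N)"
proof -
  have "- char_matrix N (- (w / v)) = (- 1 / v) \<cdot>\<^sub>m (w \<cdot>\<^sub>m 1\<^sub>m n + v \<cdot>\<^sub>m N)"
    using N v by (intro eq_matI) (auto simp: char_matrix_def field_simps)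
  moreover have "dim_col (w \<cdot>\<^sub>m 1\<^sub>m n + v \<cdot>\<^sub>m N) = n"
    using N by simp
  ultimately show ?thesis
    by (simp only: char_poly_matrix[OF N] det_smult)
qed

lemma ogda_char_det_eq:
  assumes A: "A \<in> carrier_mat n n"
  shows "ogda_char_det n \<eta> A z = det ((z\<^sup>2 - z)\<^sup>2 \<cdot>\<^sub>m 1\<^sub>m n
    + (2 * z - 1)\<^sup>2 \<cdot>\<^sub>m map_mat complex_of_real (\<eta>\<^sup>2 \<cdot>\<^sub>m (A * A\<^sup>T)))"
proof -
  let ?A = "map_mat complex_of_real A"
  \<comment> \<open>Collecting the off-diagonal terms of \<open>- z B - C\<close> gives
    \<open>u A\<close> and \<open>- u\<close> times the transpose of \<open>A\<close>; the opposite
    signs turn the later difference into a sum.\<close>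
  define u where "u = (2 * z - 1) * complex_of_real \<eta>"
  have Ac: "?A \<in> carrier_mat n n" "?A\<^sup>T \<in> carrier_mat n n"
    using A by auto
  have "z\<^sup>2 \<cdot>\<^sub>m 1\<^sub>m (2 * n) - z \<cdot>\<^sub>m map_mat complex_of_real (ogda_B n \<eta> A)
          - map_mat complex_of_real (ogda_C n \<eta> A)
      = four_block_mat ((z\<^sup>2 - z) \<cdot>\<^sub>m 1\<^sub>m n) (u \<cdot>\<^sub>m ?A) ((- u) \<cdot>\<^sub>m ?A\<^sup>T) ((z\<^sup>2 - z) \<cdot>\<^sub>m 1\<^sub>m n)"
    using A by (intro eq_matI) (auto simp: ogda_B_def ogda_C_def u_def algebra_simps)
  then have "ogda_char_det n \<eta> A z = det ((z\<^sup>2 - z)\<^sup>2 \<cdot>\<^sub>m 1\<^sub>m n - u \<cdot>\<^sub>m ?A * ((- u) \<cdot>\<^sub>m ?A\<^sup>T))"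
    using Ac by (simp add: ogda_char_det_def det_four_block_scalar_diag)
  also have "u \<cdot>\<^sub>m ?A * ((- u) \<cdot>\<^sub>m ?A\<^sup>T) = (- u) \<cdot>\<^sub>m (u \<cdot>\<^sub>m (?A * ?A\<^sup>T))"
    using Ac by (simp add: mult_smult_assoc_mat[of _ n n _ n] mult_smult_distrib[of _ n n _ n])
  also have "\<dots> = (- u\<^sup>2) \<cdot>\<^sub>m (?A * ?A\<^sup>T)"
    by (intro eq_matI) (simp_all add: power2_eq_square)
  also have "?A * ?A\<^sup>T = map_mat complex_of_real (A * A\<^sup>T)"
    using A by (simp add: of_real_hom.mat_hom_mult[of _ n n _ n] map_mat_transpose)
  also have "(z\<^sup>2 - z)\<^sup>2 \<cdot>\<^sub>m 1\<^sub>m n - (- u\<^sup>2) \<cdot>\<^sub>m map_mat complex_of_real (A * A\<^sup>T)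
      = (z\<^sup>2 - z)\<^sup>2 \<cdot>\<^sub>m 1\<^sub>m n
        + (2 * z - 1)\<^sup>2 \<cdot>\<^sub>m map_mat complex_of_real (\<eta>\<^sup>2 \<cdot>\<^sub>m (A * A\<^sup>T))"
    using A by (intro eq_matI) (auto simp: u_def power_mult_distrib)
  finally show ?thesis .
qed

theorem proposition3p1:
  fixes n :: nat and A :: "real mat" and \<eta> :: real and \<alpha> :: "real poly"
  assumes "A \<in> carrier_mat n n"
    and "\<alpha> = char_poly (\<eta>\<^sup>2 \<cdot>\<^sub>m (A * A\<^sup>T))"
  shows "ogda_char_det n \<eta> A (1 / 2) \<noteq> 0 \<and>
    (\<forall>z::complex. z \<noteq> 1 / 2 \<longrightarrow>
       (ogda_char_det n \<eta> A z = 0 \<longleftrightarrow>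
        poly (map_poly complex_of_real \<alpha>) (- (((z\<^sup>2 - z) / (2 * z - 1))\<^sup>2)) = 0))"
proof (intro conjI allI impI)
  let ?N = "map_mat complex_of_real (\<eta>\<^sup>2 \<cdot>\<^sub>m (A * A\<^sup>T))"
  have N: "\<eta>\<^sup>2 \<cdot>\<^sub>m (A * A\<^sup>T) \<in> carrier_mat n n"
    using assms(1) by simp
  then have Nc: "?N \<in> carrier_mat n n"
    by simp
  \<comment> \<open>The coefficient of \<open>?N\<close> vanishes here, and \<open>1 / 16\<close> is
    the square of \<open>1 / 4 - 1 / 2\<close>.\<close>
  have "(((1 / 2)\<^sup>2 - 1 / 2)\<^sup>2 \<cdot>\<^sub>m 1\<^sub>m n + (2 * (1 / 2) - 1)\<^sup>2 \<cdot>\<^sub>m ?N)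
      = (1 / 16 :: complex) \<cdot>\<^sub>m 1\<^sub>m n"
    using assms(1) by (intro eq_matI) (auto simp: power2_eq_square)
  then show "ogda_char_det n \<eta> A (1 / 2) \<noteq> 0"
    by (simp add: ogda_char_det_eq[OF assms(1)])
  fix z :: complex
  assume "z \<noteq> 1 / 2"
  then have z: "(2 * z - 1)\<^sup>2 \<noteq> 0"
    by (simp add: field_simps)
  \<comment> \<open>Embedding into the complex numbers commutes with \<open>char_poly\<close>, so
    the scaling lemma applies to \<open>?N\<close>; its prefactor is nonzero, hence both sides
    vanish together.\<close>
  have "poly (map_poly complex_of_real \<alpha>) (- (((z\<^sup>2 - z) / (2 * z - 1))\<^sup>2))
      = (- 1 / (2 * z - 1)\<^sup>2) ^ n * ogda_char_det n \<eta> A z"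
    unfolding assms(2) of_real_hom.char_poly_hom[OF N, symmetric] power_divide
      poly_char_poly_scaled[OF Nc z] ogda_char_det_eq[OF assms(1)] ..
  then show "ogda_char_det n \<eta> A z = 0 \<longleftrightarrow>
      poly (map_poly complex_of_real \<alpha>) (- (((z\<^sup>2 - z) / (2 * z - 1))\<^sup>2)) = 0"
    using z by simp
qed

end
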